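(* Let $0<\alpha\le 1$ and consider the time-fractional initial value problem $$D_t^{\alpha}\psi(x,t)=\mathcal N[\psi(x,t)]+h(x,t),\qquad \psi(x,0)=f_0(x),$$ where $h(x,t)$ is a non-homogeneous function and $\mathcal N$ is an operator of the form $$\mathcal N[\psi(x,t)]=\sum_{p=1}^{M}\sum_{q=0}^{Q}c_p(x)\,\psi^{p}(x,t)\,D_x^{q}\psi(x,t).$$ Suppose that the solution $\psi$ is expressed as a fractional power series about $t=0$, $$\psi(x,t)=\sum_{k=0}^{\infty}\frac{\phi_k(x)}{\Gamma(k\alpha+1)}\,t^{k\alpha},\qquad t>0,$$ and that $|\psi(x,t)|<Ce^{\delta t}$ for some $C,\delta>0$, so that its general integral transform $\Psi(x,s)=T_t\{\psi(x,t)\}$ is the series $$\Psi(x,s)=\sum_{k=0}^{\infty}\frac{\nu(s)}{\omega(s)^{k\alpha+1}}\,\phi_k(x),\qquad \omega(s)>\delta,$$ with $\phi_0(x)=f_0(x)$. Then the remaining coefficients of this series solution are given by $$\phi_1(x)=\mathcal N[f_0(x)]+h(x,0)$$ and $$\phi_k(x)=D_t^{(k-1)\alpha}\left(\mathcal N\left[f_0(x)+\sum_{m=1}^{k-1}\frac{t^{m\alpha}\phi_m(x)}{\Gamma(1+m\alpha)}\right]+h(x,t)\right)\Bigg|_{t=0},\qquad k=2,3,\dots$$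
   Context: Here $x\in I$, an interval. For $0<\alpha\le1$, $D_t^{\alpha}\psi=I_t^{1-\alpha}\partial_t\psi$ is the Caputo time-fractional derivative, where $I_t^{\beta}\psi(x,t)=\frac{1}{\Gamma(\beta)}\int_0^t(t-\tau)^{\beta-1}\psi(x,\tau)\,d\tau$ for $\beta>0$ and $I_t^{0}\psi=\psi$ (Riemann-Liouville integral). $D_t^{j\alpha}$ denotes the $j$-fold iterate $D_t^{\alpha}D_t^{\alpha}\cdots D_t^{\alpha}$. $D_x^{q}$ is the $q$-th derivative in the spatial variable $x$; $M\ge1$ and $Q\ge0$ are integers and the $c_p(x)$ are coefficient functions of $x$. The general integral transform with respect to $t$ of an integrable function $g(t)$, $t\ge0$, with $|g(t)|\le Ce^{\delta t}$ for some $C,\delta>0$, is $T_t\{g\}(s)=\nu(s)\int_0^{\infty}g(t)e^{-\omega(s)t}\,dt$ for $\omega(s)>\delta$, where $\nu(s)\ne0$ and $\omega(s)$ are positive real functions.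
   Formalization: It is additionally assumed that ψ and all φ_k are Q times differentiable in x and that the series for ψ may be differentiated term by term in x up to order Q; without this the formulas can fail. Values of Caputo derivatives at t=0 are limits as t→0+. *)

theory Defs
  imports "HOL-Analysis.Analysis"
begin

definition rl_integral :: "real \<Rightarrow> (real \<Rightarrow> real) \<Rightarrow> real \<Rightarrow> real" where
  "rl_integral \<beta> g t =
     (if \<beta> = 0 then g t
      else 1 / Gamma \<beta> * (LINT \<tau>:{0..t}|lborel. (t - \<tau>) powr (\<beta> - 1) * g \<tau>))"

text \<open>
  For \<open>t > 0\<close> this is the Caputo derivative \<open>I\<^sup>1\<^sup>-\<^sup>\<alpha> (g')\<close>. The integral formula degenerates to \<open>0\<close> at
  \<open>t = 0\<close> when \<open>\<alpha> < 1\<close>, so the value at \<open>t = 0\<close> is by convention the limit from the right.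
  The values of \<open>g\<close> at \<open>t \<le> 0\<close> do not influence the result, so iteration is unaffected by
  this convention.
\<close>
definition caputo :: "real \<Rightarrow> (real \<Rightarrow> real) \<Rightarrow> real \<Rightarrow> real" where
  "caputo \<alpha> g t =
     (if t > 0 then rl_integral (1 - \<alpha>) (deriv g) t
      else Lim (at_right 0) (rl_integral (1 - \<alpha>) (deriv g)))"

definition caputo_iter :: "real \<Rightarrow> nat \<Rightarrow> (real \<Rightarrow> real) \<Rightarrow> real \<Rightarrow> real" where
  "caputo_iter \<alpha> j g = (caputo \<alpha> ^^ j) g"

text \<open>
  As \<open>deriv\<close>, the Lebesgue integral and \<open>Lim\<close> are total, this predicate states separately that
  the Caputo derivative genuinely exists for all \<open>t \<ge> 0\<close>.
\<close>
definition caputo_differentiable :: "real \<Rightarrow> (real \<Rightarrow> real) \<Rightarrow> bool" where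
  "caputo_differentiable \<alpha> g \<longleftrightarrow>
     (\<forall>t>0. g differentiable (at t)) \<and>
     (\<alpha> < 1 \<longrightarrow> (\<forall>t>0. set_integrable lborel {0..t}
                       (\<lambda>\<tau>. (t - \<tau>) powr ((1 - \<alpha>) - 1) * deriv g \<tau>))) \<and>
     (\<exists>l. (rl_integral (1 - \<alpha>) (deriv g) \<longlongrightarrow> l) (at_right 0))"

text \<open>Derivatives in \<open>x\<close> are taken within \<open>I\<close>, hence one-sided at endpoints belonging to \<open>I\<close>.\<close>
definition Dx :: "real set \<Rightarrow> nat \<Rightarrow> (real \<Rightarrow> real) \<Rightarrow> real \<Rightarrow> real" where
  "Dx I q u = ((\<lambda>v x. vector_derivative v (at x within I)) ^^ q) u"

definition times_differentiable_on :: "nat \<Rightarrow> (real \<Rightarrow> real) \<Rightarrow> real set \<Rightarrow> bool" where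
  "times_differentiable_on n u I \<longleftrightarrow> (\<forall>q<n. Dx I q u differentiable_on I)"

text \<open>The operator acts at fixed time, so \<open>\<N>[\<psi>](x,t)\<close> is \<open>nonlin_op \<dots> (\<lambda>y. \<psi> y t) x\<close>.\<close>
definition nonlin_op ::
  "real set \<Rightarrow> nat \<Rightarrow> nat \<Rightarrow> (nat \<Rightarrow> real \<Rightarrow> real) \<Rightarrow> (real \<Rightarrow> real) \<Rightarrow> real \<Rightarrow> real" where
  "nonlin_op I M Q c u x = (\<Sum>p=1..M. \<Sum>q=0..Q. c p x * u x ^ p * Dx I q u x)"

definition gen_transform ::
  "(real \<Rightarrow> real) \<Rightarrow> (real \<Rightarrow> real) \<Rightarrow> (real \<Rightarrow> real) \<Rightarrow> real \<Rightarrow> real" where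
  "gen_transform \<nu> \<omega> g s = \<nu> s * (LINT t:{0..}|lborel. g t * exp (- \<omega> s * t))"

end

theory Submission
  imports Defs
begin

text \<open>
  Fix \<open>x\<close>. Every function of \<open>t\<close> in the problem has, for \<open>t > 0\<close>, the form \<open>A (t powr \<alpha>)\<close> with an
  everywhere convergent power series \<open>A\<close>, and the proof is a comparison of coefficients of such
  series. This class (\<open>has_frac_expansion\<close>) is a ring, and the Caputo derivative acts on it as a
  weighted left shift: it kills constants and, for \<open>k \<ge> 1\<close>, takes \<open>t\<^sup>k\<^sup>\<alpha> / \<Gamma>(k \<alpha> + 1)\<close> to \<open>t\<^sup>(\<^sup>k\<^sup>-\<^sup>1\<^sup>)\<^sup>\<alpha> / \<Gamma>((k - 1) \<alpha> + 1)\<close>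
  (\<open>caputo_frac_expansion\<close>). Applied \<open>k - 1 \<ge> 1\<close> times and evaluated at \<open>0\<close>, it therefore reads off
  \<open>\<Gamma>((k - 1) \<alpha> + 1)\<close> times the coefficient of \<open>t\<^sup>(\<^sup>k\<^sup>-\<^sup>1\<^sup>)\<^sup>\<alpha>\<close> (\<open>caputo_iter_at_0\<close>).

  The series for \<open>\<psi>\<close> and the termwise differentiability in \<open>x\<close> give expansions of all \<open>D\<^sub>x\<^sup>q \<psi>\<close>, hence of
  \<open>\<N>[\<psi>]\<close>, which is polynomial in them. The equation itself then provides an expansion of the source,
  \<open>h = D\<^sub>t\<^sup>\<alpha> \<psi> - \<N>[\<psi>]\<close>. At \<open>t = 0\<close> the equation is the
  formula for \<open>\<phi>\<^sub>1\<close>. For \<open>k \<ge> 2\<close> let \<open>\<psi>\<^sub>k\<close> be the sum of the first \<open>k\<close> terms of the series; then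
  \<open>\<N>[\<psi>\<^sub>k] + h = D\<^sub>t\<^sup>\<alpha> \<psi> + (\<N>[\<psi>\<^sub>k] - \<N>[\<psi>])\<close>. The expansions of \<open>\<psi>\<^sub>k\<close> and \<open>\<psi>\<close> agree in degrees below \<open>k\<close>,
  and ring operations preserve such agreement (\<open>nonlin_fps_cutoff_cong\<close>), so the bracket does
  not contribute in degree \<open>k - 1\<close>. What remains there is the coefficient
  \<open>\<phi>\<^sub>k / \<Gamma>((k - 1) \<alpha> + 1)\<close> of \<open>D\<^sub>t\<^sup>\<alpha> \<psi>\<close>, whose Gamma factor the iterated derivative cancels.
\<close>

section \<open>Fractional power series and the Caputo shift\<close>

text \<open>
  The value at \<open>t = 0\<close> is left open: a Caputo derivative takes its value there from a limit, and
  \<open>0 powr 0 = 0\<close> would spoil the constant term of the series.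
\<close>
definition has_frac_expansion :: "real \<Rightarrow> (real \<Rightarrow> real) \<Rightarrow> real fps \<Rightarrow> bool" where
  "has_frac_expansion \<alpha> g A \<longleftrightarrow>
     fps_conv_radius A = \<infinity> \<and> (\<forall>t>0. g t = eval_fps A (t powr \<alpha>))"

definition caputo_fps :: "real \<Rightarrow> real fps \<Rightarrow> real fps" where
  "caputo_fps \<alpha> A = Abs_fps (\<lambda>k. Gamma (real (Suc k) * \<alpha> + 1) / Gamma (real k * \<alpha> + 1)
                                     * fps_nth A (Suc k))"

text \<open>
  Log-convexity of \<open>\<Gamma>\<close> on the segment from \<open>x\<close> to \<open>x + 1\<close> gives \<open>\<Gamma>(x + \<alpha>) \<le> \<Gamma>(x) x\<^sup>\<alpha>\<close>. This controls
  the weights of the Caputo shift by those of the ordinary derivative.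
\<close>
lemma Gamma_ratio_le:
  assumes "0 < \<alpha>" "\<alpha> \<le> (1::real)" "1 \<le> x"
  shows "Gamma (x + \<alpha>) / Gamma x \<le> x"
proof -
  have nz: "Gamma x \<noteq> 0"
    using assms Gamma_real_pos[of x] by linarith
  have "ln (Gamma ((1 - \<alpha>) *\<^sub>R x + \<alpha> *\<^sub>R (x + 1))) \<le> (1 - \<alpha>) * ln (Gamma x) + \<alpha> * ln (Gamma (x + 1))"
    using convex_onD[OF log_convex_Gamma_real, of \<alpha> x "x + 1"] assms by simp
  moreover have "(1 - \<alpha>) *\<^sub>R x + \<alpha> *\<^sub>R (x + 1) = x + \<alpha>"
    by (simp add: algebra_simps)
  moreover have "ln (Gamma (x + 1)) = ln x + ln (Gamma x)"
  proof -
    have "Gamma (x + 1) = x * Gamma x"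
      using assms by (intro Gamma_plus1) (auto elim!: nonpos_Ints_cases)
    then show ?thesis
      using assms nz by (simp add: ln_mult)
  qed
  ultimately have "ln (Gamma (x + \<alpha>)) \<le> ln (Gamma x) + \<alpha> * ln x"
    by (simp add: algebra_simps)
  also have "\<dots> \<le> ln (Gamma x) + ln x"
    using assms mult_right_mono[of \<alpha> 1 "ln x"] by simp
  also have "\<dots> = ln (x * Gamma x)"
    using assms nz by (simp add: ln_mult)
  finally have "Gamma (x + \<alpha>) \<le> x * Gamma x"
    using assms Gamma_real_pos[of x] Gamma_real_pos[of "x + \<alpha>"] by simp
  then show ?thesis
    using assms Gamma_real_pos[of x] by (simp add: field_simps)
qed

lemma Gamma_mult_plus1_nonzero:
  assumes "0 < \<alpha>"
  shows "Gamma (real k * \<alpha> + 1) \<noteq> 0"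
proof -
  have "0 < real k * \<alpha> + 1"
    using assms by (intro add_nonneg_pos) auto
  then show ?thesis
    using Gamma_real_pos[of "real k * \<alpha> + 1"] by linarith
qed

lemma caputo_fps_conv_radius:
  assumes \<alpha>: "0 < \<alpha>" "\<alpha> \<le> 1" and A: "fps_conv_radius A = \<infinity>"
  shows "fps_conv_radius (caputo_fps \<alpha> A) = \<infinity>"
  unfolding fps_conv_radius_def
proof (rule conv_radius_inftyI'')
  fix z :: real
  have "fps_conv_radius (fps_deriv A) = \<infinity>"
    using fps_conv_radius_deriv[of A] A by simp
  then have summ: "summable (\<lambda>k. norm (fps_nth (fps_deriv A) k * z ^ k))"
    by (intro norm_summable_fps) simp
  show "summable (\<lambda>k. fps_nth (caputo_fps \<alpha> A) k * z ^ k)"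
  proof (rule summable_comparison_test'[OF summ, of 0])
    fix k :: nat
    have "Gamma (real k * \<alpha> + 1 + \<alpha>) / Gamma (real k * \<alpha> + 1) \<le> real k * \<alpha> + 1"
      using \<alpha> by (intro Gamma_ratio_le) auto
    also have "\<dots> \<le> real (Suc k)"
      using \<alpha> mult_left_mono[of \<alpha> 1 "real k"] by simp
    finally have "Gamma (real (Suc k) * \<alpha> + 1) / Gamma (real k * \<alpha> + 1) \<le> real (Suc k)"
      by (simp add: algebra_simps)
    moreover have "0 \<le> Gamma (real (Suc k) * \<alpha> + 1) / Gamma (real k * \<alpha> + 1)"
      using \<alpha> by (intro divide_nonneg_nonneg Gamma_real_nonneg) (auto intro: add_nonneg_pos)
    ultimately have "\<bar>Gamma (real (Suc k) * \<alpha> + 1) / Gamma (real k * \<alpha> + 1)\<bar> \<le> real (Suc k)"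
      by simp
    then have "\<bar>Gamma (real (Suc k) * \<alpha> + 1) / Gamma (real k * \<alpha> + 1)\<bar> * \<bar>fps_nth A (Suc k) * z ^ k\<bar>
        \<le> real (Suc k) * \<bar>fps_nth A (Suc k) * z ^ k\<bar>"
      by (intro mult_right_mono) auto
    then show "norm (fps_nth (caputo_fps \<alpha> A) k * z ^ k) \<le> norm (fps_nth (fps_deriv A) k * z ^ k)"
      by (simp add: caputo_fps_def abs_mult mult.assoc del: of_nat_Suc)
  qed
qed

section \<open>The Caputo derivative of a fractional power series\<close>

text \<open>
  Substituting \<open>\<tau> = t x\<close> reduces this to Euler's Beta integral. It is the fractional integral of a
  single power, and gives the action of the Caputo derivative on one term of a series.
\<close>
lemma Beta_integral_scaled:
  fixes a b t :: real
  assumes "0 < a" "0 < b" "0 < t"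
  shows "set_integrable lborel {0..t} (\<lambda>\<tau>. (t - \<tau>) powr (b - 1) * \<tau> powr (a - 1))" (is ?I)
    and "(LINT \<tau>:{0..t}|lborel. (t - \<tau>) powr (b - 1) * \<tau> powr (a - 1)) = Beta a b * t powr (a + b - 1)" (is ?L)
proof -
  let ?f = "\<lambda>x. x powr (a - 1) * (1 - x) powr (b - 1) :: real"
  let ?F = "\<lambda>\<tau>. indicator {0..t} \<tau> *\<^sub>R ((t - \<tau>) powr (b - 1) * \<tau> powr (a - 1))"
  have meas: "?f \<in> borel_measurable borel" by measurable
  have "?f integrable_on {0..1}"
    using has_integral_Beta_real[OF assms(1,2)] by blast
  then have "?f absolutely_integrable_on {0..1}"
    by (intro nonnegative_absolutely_integrable_1) auto
  then have int: "set_integrable lborel {0..1} ?f"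
    unfolding set_integrable_def using meas by (subst (asm) integrable_completion) auto
  have val: "(LINT x:{0..1}|lborel. ?f x) = Beta a b"
    using set_borel_integral_eq_integral(2)[OF int]
      integral_unique[OF has_integral_Beta_real[OF assms(1,2)]] by simp
  have scale: "?F (0 + t * x) = t powr (a + b - 2) * (indicator {0..1} x *\<^sub>R ?f x)" for x
  proof (cases "x \<in> {0..1}")
    case True
    have "(t - t * x) powr (b - 1) = t powr (b - 1) * (1 - x) powr (b - 1)"
      using True assms by (subst powr_mult[symmetric]) (auto simp: algebra_simps)
    moreover have "(t * x) powr (a - 1) = t powr (a - 1) * x powr (a - 1)"
      using True assms by (simp add: powr_mult)
    moreover have "t powr (b - 1) * t powr (a - 1) = t powr (a + b - 2)"
      by (simp add: powr_add[symmetric] algebra_simps)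
    moreover have "t * x \<in> {0..t}" using True assms by (auto simp: mult_le_cancel_left1)
    ultimately show ?thesis using True by (simp add: algebra_simps)
  next
    case False
    then have "t * x \<notin> {0..t}"
      using assms by (auto simp: zero_le_mult_iff mult_le_cancel_left1)
    then show ?thesis using False by simp
  qed
  have "integrable lborel (\<lambda>x. ?F (0 + t * x))"
    unfolding scale using int unfolding set_integrable_def by (intro integrable_mult_right)
  then show ?I
    unfolding set_integrable_def using assms by (subst (asm) lborel_integrable_real_affine_iff) auto
  have "(LINT \<tau>:{0..t}|lborel. (t - \<tau>) powr (b - 1) * \<tau> powr (a - 1))
      = t * (t powr (a + b - 2) * (LINT x:{0..1}|lborel. ?f x))"
    unfolding set_lebesgue_integral_def
    using assms by (subst lborel_integral_real_affine[where c = t and t = 0]) (simp_all only: scale, simp)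
  then show ?L
    using assms unfolding val by (simp add: powr_mult_base algebra_simps)
qed


lemma frac_expansion_deriv:
  assumes g: "has_frac_expansion \<alpha> g A" and t: "0 < t"
  shows "(g has_field_derivative eval_fps (fps_deriv A) (t powr \<alpha>) * (\<alpha> * t powr (\<alpha> - 1))) (at t)"
proof -
  have A: "fps_conv_radius A = \<infinity>" and eq: "\<And>s. s \<in> {0<..} \<Longrightarrow> eval_fps A (s powr \<alpha>) = g s"
    using g by (auto simp: has_frac_expansion_def)
  have "((\<lambda>s. eval_fps A (s powr \<alpha>)) has_field_derivative
      eval_fps (fps_deriv A) (t powr \<alpha>) * (\<alpha> * t powr (\<alpha> - 1))) (at t)"
    using t A
    by (intro DERIV_chain2[where f = "eval_fps A"] has_field_derivative_eval_fps)
       (auto intro!: has_real_derivative_powr)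
  then show ?thesis
    by (rule has_field_derivative_transform_within_open[where S = "{0<..}"]) (use t eq in auto)
qed

lemma frac_expansion_deriv_sums:
  assumes g: "has_frac_expansion \<alpha> g A" and t: "0 < t"
  shows "(\<lambda>k. fps_nth A (Suc k) * (real (Suc k) * \<alpha>) * t powr (real (Suc k) * \<alpha> - 1)) sums deriv g t"
    and "summable (\<lambda>k. norm (fps_nth A (Suc k) * (real (Suc k) * \<alpha>) * t powr (real (Suc k) * \<alpha> - 1)))"
proof -
  have "fps_conv_radius (fps_deriv A) = \<infinity>"
    using fps_conv_radius_deriv[of A] g by (simp add: has_frac_expansion_def)
  then have r: "ereal (norm (t powr \<alpha>)) < fps_conv_radius (fps_deriv A)"
    by simp
  have eq: "fps_nth (fps_deriv A) k * (t powr \<alpha>) ^ k * (\<alpha> * t powr (\<alpha> - 1))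
      = fps_nth A (Suc k) * (real (Suc k) * \<alpha>) * t powr (real (Suc k) * \<alpha> - 1)" for k
  proof -
    have "(t powr \<alpha>) ^ k * t powr (\<alpha> - 1) = t powr (real (Suc k) * \<alpha> - 1)"
      using t by (simp add: powr_power powr_add[symmetric] algebra_simps)
    then show ?thesis
      by (simp add: algebra_simps)
  qed
  show "(\<lambda>k. fps_nth A (Suc k) * (real (Suc k) * \<alpha>) * t powr (real (Suc k) * \<alpha> - 1)) sums deriv g t"
    using sums_mult2[OF sums_eval_fps[OF r], of "\<alpha> * t powr (\<alpha> - 1)"]
      DERIV_imp_deriv[OF frac_expansion_deriv[OF g t]] by (simp only: eq)
  show "summable (\<lambda>k. norm (fps_nth A (Suc k) * (real (Suc k) * \<alpha>) * t powr (real (Suc k) * \<alpha> - 1)))"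
    using summable_mult2[OF norm_summable_fps[OF r], of "norm (\<alpha> * t powr (\<alpha> - 1))"]
    by (simp only: eq norm_mult[symmetric])
qed

text \<open>
  Integrating the series of \<open>deriv g\<close> term by term is legitimate because the kernel is nonnegative:
  the \<open>L\<^sup>1\<close> norms of the terms are, up to the factor \<open>\<Gamma>(1 - \<alpha>)\<close>, the absolute values of the terms of
  the shifted series, which converges absolutely by \<open>caputo_fps_conv_radius\<close>.
\<close>
lemma rl_integral_frac_expansion:
  assumes \<alpha>: "0 < \<alpha>" "\<alpha> < 1" and g: "has_frac_expansion \<alpha> g A" and t: "0 < t"
  shows "set_integrable lborel {0..t} (\<lambda>\<tau>. (t - \<tau>) powr ((1 - \<alpha>) - 1) * deriv g \<tau>)" (is ?I)
    and "rl_integral (1 - \<alpha>) (deriv g) t = eval_fps (caputo_fps \<alpha> A) (t powr \<alpha>)" (is ?V)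
proof -
  define a where "a k = fps_nth A (Suc k) * (real (Suc k) * \<alpha>)" for k
  define K where "K k \<tau> = indicator {0..t} \<tau> *\<^sub>R ((t - \<tau>) powr ((1 - \<alpha>) - 1) * \<tau> powr (real (Suc k) * \<alpha> - 1))"
    for k \<tau>
  define F where "F \<tau> = indicator {0..t} \<tau> *\<^sub>R ((t - \<tau>) powr ((1 - \<alpha>) - 1) * deriv g \<tau>)" for \<tau>
  define B where "B = caputo_fps \<alpha> A"
  have pos: "0 < real (Suc k) * \<alpha>" for k
    using \<alpha> by simp
  have K_int: "integrable lborel (K k)"
    and K_val: "integral\<^sup>L lborel (K k) = Beta (real (Suc k) * \<alpha>) (1 - \<alpha>) * t powr (real k * \<alpha>)" for k
    using Beta_integral_scaled[OF pos[of k] _ t, of "1 - \<alpha>"] \<alpha>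
    unfolding set_integrable_def set_lebesgue_integral_def K_def
    by (simp_all add: algebra_simps)
  have coeff: "a k * Beta (real (Suc k) * \<alpha>) (1 - \<alpha>) = Gamma (1 - \<alpha>) * fps_nth B k" for k
  proof -
    have "Gamma (real (Suc k) * \<alpha> + 1) = real (Suc k) * \<alpha> * Gamma (real (Suc k) * \<alpha>)"
      using pos[of k] by (intro Gamma_plus1) (auto elim!: nonpos_Ints_cases)
    then show ?thesis
      by (simp add: a_def B_def caputo_fps_def Beta_def algebra_simps)
  qed
  have aK_val: "integral\<^sup>L lborel (\<lambda>\<tau>. a k * K k \<tau>) = Gamma (1 - \<alpha>) * (fps_nth B k * (t powr \<alpha>) ^ k)" for k
  proof -
    have "integral\<^sup>L lborel (\<lambda>\<tau>. a k * K k \<tau>) = a k * Beta (real (Suc k) * \<alpha>) (1 - \<alpha>) * t powr (real k * \<alpha>)"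
      by (simp add: K_val)
    then show ?thesis
      unfolding coeff using t by (simp add: powr_power algebra_simps)
  qed
  have norm_val: "(\<integral>\<tau>. norm (a k * K k \<tau>) \<partial>lborel)
      = Gamma (1 - \<alpha>) * norm (fps_nth B k * (t powr \<alpha>) ^ k)" for k
  proof -
    have K_nonneg: "0 \<le> K k \<tau>" for \<tau>
      by (simp add: K_def)
    have "(\<integral>\<tau>. norm (a k * K k \<tau>) \<partial>lborel) = \<bar>a k\<bar> * integral\<^sup>L lborel (K k)"
      using K_nonneg by (simp add: abs_mult)
    also have "\<dots> = \<bar>integral\<^sup>L lborel (\<lambda>\<tau>. a k * K k \<tau>)\<bar>"
      using K_nonneg by (simp add: abs_mult integral_nonneg_AE)
    also have "\<dots> = Gamma (1 - \<alpha>) * norm (fps_nth B k * (t powr \<alpha>) ^ k)"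
      unfolding aK_val using \<alpha> by (simp add: abs_mult)
    finally show ?thesis .
  qed
  have B_rad: "ereal (norm (t powr \<alpha>)) < fps_conv_radius B"
    using caputo_fps_conv_radius[of \<alpha> A] \<alpha> g by (simp add: B_def has_frac_expansion_def)
  have F_sums: "(\<lambda>k. a k * K k \<tau>) sums F \<tau>"
    and F_summ: "summable (\<lambda>k. norm (a k * K k \<tau>))" if "\<tau> \<noteq> 0" for \<tau>
  proof -
    show "(\<lambda>k. a k * K k \<tau>) sums F \<tau>"
    proof (cases "\<tau> \<in> {0..t}")
      case True
      with that have "0 < \<tau>" by simp
      from sums_mult[OF frac_expansion_deriv_sums(1)[OF g this], of "(t - \<tau>) powr ((1 - \<alpha>) - 1)"]
      show ?thesis using True by (simp add: a_def K_def F_def mult_ac del: of_nat_Suc)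
    qed (simp add: K_def F_def)
    show "summable (\<lambda>k. norm (a k * K k \<tau>))"
    proof (cases "\<tau> \<in> {0..t}")
      case True
      with that have "0 < \<tau>" by simp
      from summable_mult[OF frac_expansion_deriv_sums(2)[OF g this], of "norm ((t - \<tau>) powr ((1 - \<alpha>) - 1))"]
      show ?thesis using True by (simp add: a_def K_def abs_mult mult_ac del: of_nat_Suc)
    qed (simp add: K_def)
  qed
  \<comment> \<open>At \<open>0\<close> every term of the series vanishes, whereas \<open>deriv g 0\<close> is arbitrary.\<close>
  have ae0: "AE \<tau> in lborel. \<tau> \<noteq> (0::real)"
    by (rule AE_lborel_singleton)
  have ae_summ: "AE \<tau> in lborel. summable (\<lambda>k. norm (a k * K k \<tau>))"
    using ae0 by eventually_elim (rule F_summ)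
  have summ: "summable (\<lambda>k. \<integral>\<tau>. norm (a k * K k \<tau>) \<partial>lborel)"
    unfolding norm_val by (intro summable_mult norm_summable_fps B_rad)
  have aK_int: "integrable lborel (\<lambda>\<tau>. a k * K k \<tau>)" for k
    using K_int by (intro integrable_mult_right)
  let ?S = "\<lambda>\<tau>. \<Sum>k. a k * K k \<tau>"
  have S_int: "integrable lborel ?S"
    by (rule integrable_suminf[OF aK_int ae_summ summ])
  have S_sums: "(\<lambda>k. integral\<^sup>L lborel (\<lambda>\<tau>. a k * K k \<tau>)) sums integral\<^sup>L lborel ?S"
    by (rule sums_integral[OF aK_int ae_summ summ])
  have F_eq: "F \<tau> = (if \<tau> = 0 then F 0 else ?S \<tau>)" for \<tau>
    using sums_unique[OF F_sums, of \<tau>] by simp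
  have "(\<lambda>\<tau>. if \<tau> = 0 then F 0 else ?S \<tau>) \<in> borel_measurable lborel"
    using borel_measurable_integrable[OF S_int] by (intro measurable_If) auto
  then have F_meas: "F \<in> borel_measurable lborel"
    by (subst measurable_cong[OF F_eq])
  have ae_eq: "AE \<tau> in lborel. F \<tau> = ?S \<tau>"
    using ae0 by eventually_elim (simp add: F_eq)
  have "integrable lborel F"
    using integrable_cong_AE[OF F_meas borel_measurable_integrable[OF S_int] ae_eq] S_int by blast
  then show ?I
    unfolding set_integrable_def F_def .
  have "integral\<^sup>L lborel F = integral\<^sup>L lborel ?S"
    by (rule integral_cong_AE[OF F_meas borel_measurable_integrable[OF S_int] ae_eq])
  also have "\<dots> = Gamma (1 - \<alpha>) * eval_fps B (t powr \<alpha>)"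
    using S_sums sums_mult[OF sums_eval_fps[OF B_rad], of "Gamma (1 - \<alpha>)"]
    unfolding aK_val by (rule sums_unique2)
  finally show ?V
    using \<alpha> less_imp_neq[OF Gamma_real_pos[of "1 - \<alpha>"]]
    by (simp add: rl_integral_def set_lebesgue_integral_def F_def[abs_def] B_def)
qed

lemma rl_integral_deriv_frac_expansion:
  assumes \<alpha>: "0 < \<alpha>" "\<alpha> \<le> 1" and g: "has_frac_expansion \<alpha> g A" and t: "0 < t"
  shows "rl_integral (1 - \<alpha>) (deriv g) t = eval_fps (caputo_fps \<alpha> A) (t powr \<alpha>)"
proof (cases "\<alpha> = 1")
  case True
  \<comment> \<open>\<open>rl_integral 0\<close> is the identity, and the Gamma quotients reduce to \<open>k + 1\<close>.\<close>
  have "caputo_fps \<alpha> A = fps_deriv A"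
  proof (rule fps_ext)
    fix k
    have "Gamma (real (Suc k) + 1) = real (Suc k) * Gamma (real (Suc k))"
      by (intro Gamma_plus1) (auto elim!: nonpos_Ints_cases)
    moreover have "Gamma (1 + real k) \<noteq> 0"
      using Gamma_real_pos[of "1 + real k"] by linarith
    ultimately show "fps_nth (caputo_fps \<alpha> A) k = fps_nth (fps_deriv A) k"
      by (simp add: caputo_fps_def True add_ac)
  qed
  then show ?thesis
    using DERIV_imp_deriv[OF frac_expansion_deriv[OF g t]] t True by (simp add: rl_integral_def)
next
  case False
  then show ?thesis
    using rl_integral_frac_expansion(2)[OF _ _ g t] \<alpha> by simp
qed

lemma frac_expansion_tendsto:
  assumes "0 < \<alpha>" "has_frac_expansion \<alpha> g A"
  shows "(g \<longlongrightarrow> fps_nth A 0) (at_right 0)"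
proof -
  have "isCont (eval_fps A) 0"
    using continuous_on_eval_fps[of A] assms(2)
    by (simp add: has_frac_expansion_def continuous_on_eq_continuous_at)
  moreover have "((\<lambda>t::real. t powr \<alpha>) \<longlongrightarrow> 0) (at_right 0)"
    by (rule tendsto_zero_powrI) (use assms(1) in \<open>auto intro: tendsto_const tendsto_ident_at simp: eventually_at_filter\<close>)
  ultimately have "((\<lambda>t. eval_fps A (t powr \<alpha>)) \<longlongrightarrow> eval_fps A 0) (at_right 0)"
    by (rule isCont_tendsto_compose)
  moreover have "eventually (\<lambda>t. eval_fps A (t powr \<alpha>) = g t) (at_right 0)"
    using assms(2) by (auto simp: eventually_at_filter has_frac_expansion_def)
  ultimately show ?thesis
    by (simp add: eval_fps_at_0 tendsto_cong)
qed

lemma caputo_frac_expansion: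
  assumes \<alpha>: "0 < \<alpha>" "\<alpha> \<le> 1" and g: "has_frac_expansion \<alpha> g A"
  shows "has_frac_expansion \<alpha> (caputo \<alpha> g) (caputo_fps \<alpha> A)"
    and "caputo_differentiable \<alpha> g"
    and "caputo \<alpha> g 0 = fps_nth (caputo_fps \<alpha> A) 0"
proof -
  have rad: "fps_conv_radius (caputo_fps \<alpha> A) = \<infinity>"
    using g by (intro caputo_fps_conv_radius[OF \<alpha>]) (simp add: has_frac_expansion_def)
  have rl: "has_frac_expansion \<alpha> (rl_integral (1 - \<alpha>) (deriv g)) (caputo_fps \<alpha> A)"
    using rad rl_integral_deriv_frac_expansion[OF \<alpha> g] by (simp add: has_frac_expansion_def)
  show "has_frac_expansion \<alpha> (caputo \<alpha> g) (caputo_fps \<alpha> A)"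
    using rl by (simp add: has_frac_expansion_def caputo_def)
  have lim: "(rl_integral (1 - \<alpha>) (deriv g) \<longlongrightarrow> fps_nth (caputo_fps \<alpha> A) 0) (at_right 0)"
    by (rule frac_expansion_tendsto[OF \<alpha>(1) rl])
  show "caputo \<alpha> g 0 = fps_nth (caputo_fps \<alpha> A) 0"
    using tendsto_Lim[OF _ lim] by (simp add: caputo_def)
  show "caputo_differentiable \<alpha> g"
    unfolding caputo_differentiable_def
    using frac_expansion_deriv[OF g] rl_integral_frac_expansion(1)[OF \<alpha>(1) _ g] lim
    by (auto simp: real_differentiable_def)
qed

lemma caputo_iter_frac_expansion:
  assumes "0 < \<alpha>" "\<alpha> \<le> 1" "has_frac_expansion \<alpha> g A"
  shows "has_frac_expansion \<alpha> (caputo_iter \<alpha> j g) ((caputo_fps \<alpha> ^^ j) A)"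
  using assms by (induction j) (auto simp: caputo_iter_def intro: caputo_frac_expansion(1))

lemma caputo_fps_iter_nth:
  assumes "0 < \<alpha>"
  shows "fps_nth ((caputo_fps \<alpha> ^^ j) A) n
    = Gamma (real (n + j) * \<alpha> + 1) / Gamma (real n * \<alpha> + 1) * fps_nth A (n + j)"
proof (induction j arbitrary: n)
  case 0
  then show ?case
    using Gamma_mult_plus1_nonzero[OF assms, of n] by simp
next
  case (Suc j)
  then show ?case
    using Gamma_mult_plus1_nonzero[OF assms, of "Suc n"]
    by (simp add: caputo_fps_def[of \<alpha> "(caputo_fps \<alpha> ^^ j) A"] Suc.IH del: of_nat_Suc of_nat_add)
qed

text \<open>
  The order \<open>Suc j\<close> is positive because the last Caputo derivative must supply the value at \<open>0\<close> as a
  limit; \<open>g 0\<close> itself is unrelated to \<open>A\<close>.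
\<close>
lemma caputo_iter_at_0:
  assumes "0 < \<alpha>" "\<alpha> \<le> 1" "has_frac_expansion \<alpha> g A"
  shows "caputo_iter \<alpha> (Suc j) g 0 = Gamma (real (Suc j) * \<alpha> + 1) * fps_nth A (Suc j)"
proof -
  have "caputo_iter \<alpha> (Suc j) g 0 = fps_nth ((caputo_fps \<alpha> ^^ Suc j) A) 0"
    using caputo_frac_expansion(3)[OF assms(1,2) caputo_iter_frac_expansion[OF assms, of j]]
    by (simp add: caputo_iter_def)
  then show ?thesis
    unfolding caputo_fps_iter_nth[OF assms(1)] by simp
qed


section \<open>The ring of fractional power series\<close>

lemma frac_expansion_const: "has_frac_expansion \<alpha> (\<lambda>t. c) (fps_const c)"
  by (simp add: has_frac_expansion_def)

lemma frac_expansion_add: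
  assumes "has_frac_expansion \<alpha> f A" "has_frac_expansion \<alpha> g B"
  shows "has_frac_expansion \<alpha> (\<lambda>t. f t + g t) (A + B)"
  using assms fps_conv_radius_add[of A B] by (auto simp: has_frac_expansion_def eval_fps_add)

lemma frac_expansion_diff:
  assumes "has_frac_expansion \<alpha> f A" "has_frac_expansion \<alpha> g B"
  shows "has_frac_expansion \<alpha> (\<lambda>t. f t - g t) (A - B)"
  using assms fps_conv_radius_diff[of A B] by (auto simp: has_frac_expansion_def eval_fps_diff)

lemma frac_expansion_mult:
  assumes "has_frac_expansion \<alpha> f A" "has_frac_expansion \<alpha> g B"
  shows "has_frac_expansion \<alpha> (\<lambda>t. f t * g t) (A * B)"
  using assms fps_conv_radius_mult[of A B] by (auto simp: has_frac_expansion_def eval_fps_mult)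

lemma frac_expansion_power:
  assumes "has_frac_expansion \<alpha> f A"
  shows "has_frac_expansion \<alpha> (\<lambda>t. f t ^ n) (A ^ n)"
  using assms fps_conv_radius_power[of A n] by (auto simp: has_frac_expansion_def eval_fps_power)

lemma frac_expansion_sum:
  assumes "\<And>i. i \<in> S \<Longrightarrow> has_frac_expansion \<alpha> (f i) (A i)"
  shows "has_frac_expansion \<alpha> (\<lambda>t. \<Sum>i\<in>S. f i t) (\<Sum>i\<in>S. A i)"
  using assms
proof (induction S rule: infinite_finite_induct)
  case (insert i S)
  then show ?case by (simp add: frac_expansion_add)
qed (simp_all add: has_frac_expansion_def)

lemma frac_expansion_cong:
  assumes "has_frac_expansion \<alpha> f A" "\<And>t. 0 < t \<Longrightarrow> f t = g t"
  shows "has_frac_expansion \<alpha> g A"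
  using assms by (simp add: has_frac_expansion_def)

text \<open>
  Every \<open>r > 0\<close> is of the form \<open>t powr \<alpha>\<close>, so convergence for all \<open>t > 0\<close> forces the radius of
  convergence to be infinite.
\<close>
lemma frac_expansion_sums:
  assumes \<alpha>: "0 < \<alpha>" and sums: "\<And>t. 0 < t \<Longrightarrow> (\<lambda>k. a k * t powr (real k * \<alpha>)) sums g t"
  shows "has_frac_expansion \<alpha> g (Abs_fps a)"
proof -
  have pow: "t powr (real k * \<alpha>) = (t powr \<alpha>) ^ k" if "0 < t" for t k
    using that by (simp add: powr_power)
  have "conv_radius a = \<infinity>"
  proof (rule conv_radius_inftyI')
    fix r :: real assume "0 < r"
    moreover have "(r powr (1 / \<alpha>)) powr \<alpha> = r"
      using \<alpha> \<open>0 < r\<close> by (simp add: powr_powr)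
    ultimately have "summable (\<lambda>k. a k * r ^ k)"
      using sums_summable[OF sums[of "r powr (1 / \<alpha>)"]] pow[of "r powr (1 / \<alpha>)"] by simp
    with \<open>0 < r\<close> show "\<exists>z. norm z = r \<and> summable (\<lambda>k. a k * z ^ k)"
      by (intro exI[of _ r]) simp
  qed
  moreover have "g t = eval_fps (Abs_fps a) (t powr \<alpha>)" if "0 < t" for t
    using sums_unique[OF sums[OF that]] that by (simp add: eval_fps_def pow)
  ultimately show ?thesis
    by (simp add: has_frac_expansion_def fps_conv_radius_def fps_nth_Abs_fps[abs_def])
qed

lemma frac_expansion_cutoff:
  "has_frac_expansion \<alpha> (\<lambda>t. \<Sum>m<n. fps_nth A m * t powr (real m * \<alpha>)) (fps_cutoff n A)"
proof -
  have "eval_fps (fps_cutoff n A) z = (\<Sum>m<n. fps_nth A m * z ^ m)" for z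
    unfolding eval_fps_def by (subst suminf_finite[of "{..<n}"]) auto
  moreover have "fps_conv_radius (fps_cutoff n A) = \<infinity>"
    unfolding fps_of_poly_truncate[symmetric] by (rule fps_conv_radius_fps_of_poly)
  ultimately show ?thesis
    by (auto simp: has_frac_expansion_def powr_power intro!: sum.cong)
qed

section \<open>The nonlinear operator on coefficients\<close>

text \<open>The series \<open>U q\<close> stands for the expansion of the \<open>q\<close>-th spatial derivative.\<close>
definition nonlin_fps :: "nat \<Rightarrow> nat \<Rightarrow> (nat \<Rightarrow> real) \<Rightarrow> (nat \<Rightarrow> real fps) \<Rightarrow> real fps" where
  "nonlin_fps M Q c U = (\<Sum>p=1..M. \<Sum>q=0..Q. fps_const (c p) * U 0 ^ p * U q)"

lemma nonlin_op_frac_expansion: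
  assumes "\<And>q. q \<le> Q \<Longrightarrow> has_frac_expansion \<alpha> (\<lambda>t. Dx I q (u t) x) (U q)"
  shows "has_frac_expansion \<alpha> (\<lambda>t. nonlin_op I M Q c (u t) x) (nonlin_fps M Q (\<lambda>p. c p x) U)"
proof -
  have "has_frac_expansion \<alpha> (\<lambda>t. u t x) (U 0)"
    using assms[of 0] by (simp add: Dx_def)
  then show ?thesis
    unfolding nonlin_op_def nonlin_fps_def
    by (intro frac_expansion_sum frac_expansion_mult frac_expansion_power frac_expansion_const assms) auto
qed

text \<open>
  Equality of \<open>fps_cutoff n\<close> is congruence modulo \<open>fps_X ^ n\<close>, hence compatible with ring operations.
\<close>
lemma fps_cutoff_mult_cong:
  fixes A B :: "'a :: semiring_1 fps"
  assumes "fps_cutoff n A = fps_cutoff n A'" "fps_cutoff n B = fps_cutoff n B'"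
  shows "fps_cutoff n (A * B) = fps_cutoff n (A' * B')"
  using assms by (auto simp: fps_cutoff_eq_fps_cutoff_iff fps_mult_nth intro!: sum.cong)

lemma fps_cutoff_power_cong:
  fixes A :: "'a :: semiring_1 fps"
  assumes "fps_cutoff n A = fps_cutoff n A'"
  shows "fps_cutoff n (A ^ p) = fps_cutoff n (A' ^ p)"
  by (induction p) (auto intro: fps_cutoff_mult_cong assms)

lemma nonlin_fps_cutoff_cong:
  assumes "\<And>q. q \<le> Q \<Longrightarrow> fps_cutoff n (U q) = fps_cutoff n (V q)"
  shows "fps_cutoff n (nonlin_fps M Q c U) = fps_cutoff n (nonlin_fps M Q c V)"
proof -
  have "fps_cutoff n (fps_const (c p) * U 0 ^ p * U q) = fps_cutoff n (fps_const (c p) * V 0 ^ p * V q)"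
    if "q \<le> Q" for p q
    using assms that by (intro fps_cutoff_mult_cong fps_cutoff_power_cong) auto
  then show ?thesis
    by (auto simp: nonlin_fps_def fps_cutoff_eq_fps_cutoff_iff fps_sum_nth intro!: sum.cong)
qed

section \<open>Spatial derivatives within the interval\<close>

text \<open>
  Functions that agree on \<open>I\<close> have the same candidates for a derivative within \<open>I\<close>, from which the
  choice operator selects.
\<close>
lemma Dx_cong:
  assumes "\<And>y. y \<in> I \<Longrightarrow> u y = v y" "x \<in> I"
  shows "Dx I q u x = Dx I q v x"
  using assms(2)
proof (induction q arbitrary: x)
  case 0
  then show ?case using assms(1) by (simp add: Dx_def)
next
  case (Suc q)
  then have "vector_derivative (Dx I q u) (at x within I) = vector_derivative (Dx I q v) (at x within I)"
    by (intro vector_derivative_cong_eq always_eventually) auto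
  then show ?case by (simp add: Dx_def)
qed

lemma nonlin_op_cong:
  assumes "\<And>y. y \<in> I \<Longrightarrow> u y = v y" "x \<in> I"
  shows "nonlin_op I M Q c u x = nonlin_op I M Q c v x"
  using Dx_cong[OF assms] assms by (simp add: nonlin_op_def)

text \<open>No point of the interval is isolated, which makes derivatives within it unique.\<close>
lemma interval_at_within_nontrivial:
  fixes I :: "real set"
  assumes "is_interval I" "interior I \<noteq> {}" "x \<in> I"
  shows "at x within I \<noteq> bot"
proof -
  obtain a where "I \<noteq> {a}"
    using assms by fastforce
  then have "x islimpt I"
    using assms by (intro connected_imp_perfect) (auto simp: is_interval_connected)
  then show ?thesis
    by (simp add: trivial_limit_within)
qed

lemma Dx_linear_combination:
  assumes I: "is_interval I" "interior I \<noteq> {}"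
    and u: "\<And>i. i \<in> F \<Longrightarrow> times_differentiable_on Q (u i) I"
    and q: "q \<le> Q" and x: "x \<in> I"
  shows "Dx I q (\<lambda>y. \<Sum>i\<in>F. w i * u i y) x = (\<Sum>i\<in>F. w i * Dx I q (u i) x)"
  using q x
proof (induction q arbitrary: x)
  case 0
  then show ?case by (simp add: Dx_def)
next
  case (Suc q)
  have "(Dx I q (u i) has_vector_derivative Dx I (Suc q) (u i) x) (at x within I)" if "i \<in> F" for i
  proof -
    have "Dx I q (u i) differentiable (at x within I)"
      using u[OF that] Suc.prems by (auto simp: times_differentiable_on_def differentiable_on_def)
    then show ?thesis
      by (simp add: vector_derivative_works Dx_def)
  qed
  then have "((\<lambda>y. \<Sum>i\<in>F. w i * Dx I q (u i) y) has_vector_derivative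
      (\<Sum>i\<in>F. w i * Dx I (Suc q) (u i) x)) (at x within I)"
    by (intro has_vector_derivative_sum has_vector_derivative_mult_right)
  then have "(Dx I q (\<lambda>y. \<Sum>i\<in>F. w i * u i y) has_vector_derivative
      (\<Sum>i\<in>F. w i * Dx I (Suc q) (u i) x)) (at x within I)"
    using Suc by (intro has_vector_derivative_transform[where g = "Dx I q _"]) auto
  then show ?case
    using vector_derivative_within[OF interval_at_within_nontrivial[OF I Suc.prems(2)]]
    by (simp add: Dx_def)
qed

section \<open>The coefficient formulas\<close>

theorem mainTheorem1:
  fixes \<alpha> C \<delta> :: real and I S :: "real set" and M Q :: nat
    and c :: "nat \<Rightarrow> real \<Rightarrow> real"
    and \<psi> h :: "real \<Rightarrow> real \<Rightarrow> real" and f\<^sub>0 :: "real \<Rightarrow> real"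
    and \<phi> :: "nat \<Rightarrow> real \<Rightarrow> real" and \<nu> \<omega> :: "real \<Rightarrow> real"
  assumes alpha: "0 < \<alpha>" "\<alpha> \<le> 1"
    and interval: "is_interval I" "interior I \<noteq> {}"
    and M: "1 \<le> M"
    and equation: "\<And>x t. x \<in> I \<Longrightarrow> 0 \<le> t \<Longrightarrow>
          caputo \<alpha> (\<psi> x) t = nonlin_op I M Q c (\<lambda>y. \<psi> y t) x + h x t"
    and initial: "\<And>x. x \<in> I \<Longrightarrow> \<psi> x 0 = f\<^sub>0 x"
    and series: "\<And>x t. x \<in> I \<Longrightarrow> 0 < t \<Longrightarrow>
          (\<lambda>k. \<phi> k x / Gamma (real k * \<alpha> + 1) * t powr (real k * \<alpha>)) sums \<psi> x t"
    and smooth_\<psi>: "\<And>t. 0 \<le> t \<Longrightarrow> times_differentiable_on Q (\<lambda>y. \<psi> y t) I"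
    and smooth_\<phi>: "\<And>k. times_differentiable_on Q (\<phi> k) I"
    and termwise: "\<And>q x t. q \<in> {1..Q} \<Longrightarrow> x \<in> I \<Longrightarrow> 0 < t \<Longrightarrow>
          (\<lambda>k. Dx I q (\<phi> k) x / Gamma (real k * \<alpha> + 1) * t powr (real k * \<alpha>))
            sums Dx I q (\<lambda>y. \<psi> y t) x"
    and bound: "0 < C" "0 < \<delta>"
          "\<And>x t. x \<in> I \<Longrightarrow> 0 \<le> t \<Longrightarrow> \<bar>\<psi> x t\<bar> < C * exp (\<delta> * t)"
    and transform_pos: "\<And>s. s \<in> S \<Longrightarrow> 0 < \<nu> s" "\<And>s. s \<in> S \<Longrightarrow> 0 < \<omega> s"
    and transform_series: "\<And>x s. x \<in> I \<Longrightarrow> s \<in> S \<Longrightarrow> \<delta> < \<omega> s \<Longrightarrow>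
          (\<lambda>k. \<nu> s / \<omega> s powr (real k * \<alpha> + 1) * \<phi> k x) sums gen_transform \<nu> \<omega> (\<psi> x) s"
    and phi0: "\<And>x. x \<in> I \<Longrightarrow> \<phi> 0 x = f\<^sub>0 x"
  shows "\<forall>x\<in>I.
     \<phi> 1 x = nonlin_op I M Q c f\<^sub>0 x + h x 0 \<and>
     (\<forall>k\<ge>2.
        let G = (\<lambda>t. nonlin_op I M Q c
                       (\<lambda>y. f\<^sub>0 y + (\<Sum>m=1..k-1. t powr (real m * \<alpha>) * \<phi> m y
                                                  / Gamma (1 + real m * \<alpha>))) x
                     + h x t)
        in (\<forall>j<k-1. caputo_differentiable \<alpha> (caputo_iter \<alpha> j G)) \<and>
           \<phi> k x = caputo_iter \<alpha> (k - 1) G 0)"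
proof (intro ballI conjI allI impI)
  fix x assume x: "x \<in> I"
  define U where "U q = Abs_fps (\<lambda>k. Dx I q (\<phi> k) x / Gamma (real k * \<alpha> + 1))" for q
  have U: "has_frac_expansion \<alpha> (\<lambda>t. Dx I q (\<lambda>y. \<psi> y t) x) (U q)" if "q \<le> Q" for q
    unfolding U_def
  proof (rule frac_expansion_sums[OF alpha(1)])
    fix t :: real assume "0 < t"
    then show "(\<lambda>k. Dx I q (\<phi> k) x / Gamma (real k * \<alpha> + 1) * t powr (real k * \<alpha>))
        sums Dx I q (\<lambda>y. \<psi> y t) x"
      using termwise[of q x t] series[of x t] x that by (cases "q = 0") (auto simp: Dx_def)
  qed
  have \<psi>: "has_frac_expansion \<alpha> (\<psi> x) (U 0)"
    using U[of 0] by (simp add: Dx_def)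
  have coeff: "fps_nth (caputo_fps \<alpha> (U 0)) k = \<phi> (Suc k) x / Gamma (real k * \<alpha> + 1)" for k
    using Gamma_mult_plus1_nonzero[OF alpha(1), of "Suc k"]
    by (simp add: caputo_fps_def U_def Dx_def del: of_nat_Suc)
  note N\<psi> = nonlin_op_frac_expansion[where u = "\<lambda>t y. \<psi> y t", OF U, of Q M c]
  \<comment> \<open>The equation is solved for the source term.\<close>
  have h: "has_frac_expansion \<alpha> (h x)
      (caputo_fps \<alpha> (U 0) - nonlin_fps M Q (\<lambda>p. c p x) U)"
    by (rule frac_expansion_cong[OF frac_expansion_diff[OF caputo_frac_expansion(1)[OF alpha \<psi>] N\<psi>]])
       (use equation[OF x] in auto)
  have "\<phi> 1 x = caputo \<alpha> (\<psi> x) 0"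
    using caputo_frac_expansion(3)[OF alpha \<psi>] coeff[of 0] by simp
  also have "\<dots> = nonlin_op I M Q c f\<^sub>0 x + h x 0"
    using equation[OF x, of 0] nonlin_op_cong[of I "\<lambda>y. \<psi> y 0" f\<^sub>0 x] initial x by simp
  finally show "\<phi> 1 x = nonlin_op I M Q c f\<^sub>0 x + h x 0" .

  fix k :: nat assume k: "2 \<le> k"
  then obtain j where j: "k = Suc (Suc j)"
    by (metis Suc_le_D numeral_2_eq_2 Suc_le_mono)
  define v where "v t y = f\<^sub>0 y + (\<Sum>m=1..k-1. t powr (real m * \<alpha>) * \<phi> m y / Gamma (1 + real m * \<alpha>))"
    for t y
  define G where "G t = nonlin_op I M Q c (v t) x + h x t" for t
  have v_eq: "v t y = (\<Sum>m<k. t powr (real m * \<alpha>) / Gamma (real m * \<alpha> + 1) * \<phi> m y)"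
    if "0 < t" "y \<in> I" for t y
  proof -
    have "{..<k} = insert 0 {1..k-1}" using k by auto
    then show ?thesis
      using that by (simp add: v_def phi0 add.commute)
  qed
  have v: "has_frac_expansion \<alpha> (\<lambda>t. Dx I q (v t) x) (fps_cutoff k (U q))" if "q \<le> Q" for q
  proof (rule frac_expansion_cong[OF frac_expansion_cutoff])
    fix t :: real assume "0 < t"
    then have "Dx I q (v t) x
        = Dx I q (\<lambda>y. \<Sum>m<k. t powr (real m * \<alpha>) / Gamma (real m * \<alpha> + 1) * \<phi> m y) x"
      using v_eq x by (intro Dx_cong) auto
    also have "\<dots> = (\<Sum>m<k. t powr (real m * \<alpha>) / Gamma (real m * \<alpha> + 1) * Dx I q (\<phi> m) x)"
      by (rule Dx_linear_combination[OF interval smooth_\<phi> that x])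
    finally show "(\<Sum>m<k. fps_nth (U q) m * t powr (real m * \<alpha>)) = Dx I q (v t) x"
      by (simp add: U_def mult.commute)
  qed
  define R where "R = nonlin_fps M Q (\<lambda>p. c p x) (\<lambda>q. fps_cutoff k (U q))
      + (caputo_fps \<alpha> (U 0) - nonlin_fps M Q (\<lambda>p. c p x) U)"
  have G: "has_frac_expansion \<alpha> G R"
    unfolding G_def R_def by (intro frac_expansion_add nonlin_op_frac_expansion v h)
  have "fps_cutoff k (nonlin_fps M Q (\<lambda>p. c p x) (\<lambda>q. fps_cutoff k (U q)))
      = fps_cutoff k (nonlin_fps M Q (\<lambda>p. c p x) U)"
    by (rule nonlin_fps_cutoff_cong) (simp add: fps_cutoff_eq_fps_cutoff_iff)
  then have "fps_nth R (Suc j) = fps_nth (caputo_fps \<alpha> (U 0)) (Suc j)"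
    using j by (auto simp: R_def fps_cutoff_eq_fps_cutoff_iff)
  then have R: "fps_nth R (Suc j) = \<phi> k x / Gamma (real (Suc j) * \<alpha> + 1)"
    using coeff[of "Suc j"] j by simp
  have "\<phi> k x = caputo_iter \<alpha> (k - 1) G 0"
    using Gamma_mult_plus1_nonzero[OF alpha(1), of "Suc j"]
    unfolding j diff_Suc_1 caputo_iter_at_0[OF alpha G] R[unfolded j] by simp
  moreover have "caputo_differentiable \<alpha> (caputo_iter \<alpha> i G)" for i
    by (rule caputo_frac_expansion(2)[OF alpha caputo_iter_frac_expansion[OF alpha G]])
  ultimately show "let G = (\<lambda>t. nonlin_op I M Q c
                       (\<lambda>y. f\<^sub>0 y + (\<Sum>m=1..k-1. t powr (real m * \<alpha>) * \<phi> m y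
                                                  / Gamma (1 + real m * \<alpha>))) x
                     + h x t)
        in (\<forall>j<k-1. caputo_differentiable \<alpha> (caputo_iter \<alpha> j G)) \<and>
           \<phi> k x = caputo_iter \<alpha> (k - 1) G 0"
    by (simp add: Let_def G_def[abs_def] v_def[abs_def])
qed

end
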